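(* Let $\Sigma=\{\alpha_1,\alpha_2,\dots\}$ be an infinite countable alphabet, $\upsilon\notin\Sigma$ a variable, $\vec k=(k_n)_{n\in\mathbb N}\subseteq\mathbb N$ and $r,s\in\mathbb N$. If $L(\Sigma,\vec k;\upsilon)=A_1\cup\dots\cup A_r$ and $L(\Sigma,\vec k)=C_1\cup\dots\cup C_s$, then there exist a sequence $(w_n)_{n\in\mathbb N}\subseteq L(\Sigma,\vec k;\upsilon)$ with $w_n<w_{n+1}$ for every $n\in\mathbb N$ and indices $1\le i_0\le r$, $1\le j_0\le s$ such that $T_{p_1}(w_{n_1})\star\cdots\star T_{p_\lambda}(w_{n_\lambda})\in A_{i_0}$ for every $\lambda\in\mathbb N$, $n_1<\dots<n_\lambda$ in $\mathbb N$ and $p_1,\dots,p_\lambda\in\mathbb N\cup\{0\}$ with $0\le p_i\le k_{n_i}$ for all $1\le i\le\lambda$ and $0\in\{p_1,\dots,p_\lambda\}$; and $T_{p_1}(w_{n_1})\star\cdots\star T_{p_\lambda}(w_{n_\lambda})\in C_{j_0}$ for every $\lambda\in\mathbb N$, $n_1<\dots<n_\lambda$ in $\mathbb N$ and $p_1,\dots,p_\lambda\in\mathbb N$ with $1\le p_i\le k_{n_i}$ for all $1\le i\le\lambda$.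
   Context: $\mathbb N=\{1,2,\dots\}$. $\Sigma=\{\alpha_1,\alpha_2,\dots\}$ consists of distinct letters indexed by $\mathbb N$. $L(\Sigma,\vec k)$ is the set of all functions $w$ from a nonempty finite set $\mathrm{dom}(w)\subseteq\mathbb N$ into $\Sigma$ with $w(n)\in\{\alpha_1,\dots,\alpha_{k_n}\}$ for every $n\in\mathrm{dom}(w)$. $L(\Sigma,\vec k;\upsilon)$ is the set of all functions $w$ from a nonempty finite $\mathrm{dom}(w)\subseteq\mathbb N$ into $\Sigma\cup\{\upsilon\}$ with $w(n)\in\{\upsilon,\alpha_1,\dots,\alpha_{k_n}\}$ for all $n\in\mathrm{dom}(w)$ and $w(n)=\upsilon$ for at least one $n$. For $w,u\in L(\Sigma,\vec k)\cup L(\Sigma,\vec k;\upsilon)$ write $w<u$ iff $\max\mathrm{dom}(w)<\min\mathrm{dom}(u)$; then $w\star u$ is the word with domain $\mathrm{dom}(w)\cup\mathrm{dom}(u)$ agreeing with $w$ on $\mathrm{dom}(w)$ and with $u$ on $\mathrm{dom}(u)$. For $p\in\mathbb N\cup\{0\}$: $T_0(w)=w$; for $p\ge1$, $T_p(w)$ has the same domain as $w$, $T_p(w)(n)=w(n)$ if $w(n)\in\Sigma$, $T_p(w)(n)=\alpha_p$ if $w(n)=\upsilon$ and $k_n\ge p$, and $T_p(w)(n)=\alpha_{k_n}$ if $w(n)=\upsilon$ and $k_n<p$. *)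

theory Defs
  imports Main
begin

text \<open>
  The positive integers are \<open>{1..} :: nat set\<close>; the value at 0 of the families \<open>\<alpha>\<close> and \<open>k\<close>
  is never used.  A word is a finite partial function \<open>nat \<rightharpoonup> 'a\<close>, where the type \<open>'a\<close> contains
  the letters \<open>\<alpha> 1, \<alpha> 2, \<dots>\<close> and the variable \<open>\<upsilon>\<close>.
\<close>

type_synonym 'a partial_word = "nat \<rightharpoonup> 'a"

definition const_words :: "(nat \<Rightarrow> 'a) \<Rightarrow> (nat \<Rightarrow> nat) \<Rightarrow> 'a partial_word set" where
  "const_words \<alpha> k =
     {w. finite (dom w) \<and> dom w \<noteq> {} \<and> dom w \<subseteq> {1..} \<and>
         (\<forall>n\<in>dom w. the (w n) \<in> \<alpha> ` {1..k n})}"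

definition var_words :: "(nat \<Rightarrow> 'a) \<Rightarrow> 'a \<Rightarrow> (nat \<Rightarrow> nat) \<Rightarrow> 'a partial_word set" where
  "var_words \<alpha> \<upsilon> k =
     {w. finite (dom w) \<and> dom w \<noteq> {} \<and> dom w \<subseteq> {1..} \<and>
         (\<forall>n\<in>dom w. the (w n) \<in> insert \<upsilon> (\<alpha> ` {1..k n})) \<and>
         (\<exists>n\<in>dom w. the (w n) = \<upsilon>)}"

definition word_less :: "'a partial_word \<Rightarrow> 'a partial_word \<Rightarrow> bool" where
  "word_less w u \<longleftrightarrow> Max (dom w) < Min (dom u)"

definition subst_word ::
  "(nat \<Rightarrow> 'a) \<Rightarrow> 'a \<Rightarrow> (nat \<Rightarrow> nat) \<Rightarrow> nat \<Rightarrow> 'a partial_word \<Rightarrow> 'a partial_word" where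
  "subst_word \<alpha> \<upsilon> k p w =
     (if p = 0 then w
      else (\<lambda>n. map_option
             (\<lambda>a. if a = \<upsilon> then (if p \<le> k n then \<alpha> p else \<alpha> (k n)) else a) (w n)))"

text \<open>
  For words with \<open>word_less w u\<close> the domains are disjoint, so \<open>w \<star> u\<close> is \<open>w ++ u\<close>.  Iterating
  over a nonempty list from the right may start from \<open>Map.empty\<close>, since \<open>w ++ Map.empty = w\<close>.
\<close>

definition star_list :: "'a partial_word list \<Rightarrow> 'a partial_word" where
  "star_list ws = foldr (++) ws Map.empty"

text \<open>
  \<open>T\<^bsub>p\<^sub>1\<^esub>(w\<^bsub>n\<^sub>1\<^esub>) \<star> \<dots> \<star> T\<^bsub>p\<^sub>\<lambda>\<^esub>(w\<^bsub>n\<^sub>\<lambda>\<^esub>)\<close> for \<open>ps = [p\<^sub>1, \<dots>, p\<^sub>\<lambda>]\<close> and \<open>ns = [n\<^sub>1, \<dots>, n\<^sub>\<lambda>]\<close>.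
\<close>

definition subst_product ::
  "(nat \<Rightarrow> 'a) \<Rightarrow> 'a \<Rightarrow> (nat \<Rightarrow> nat) \<Rightarrow> (nat \<Rightarrow> 'a partial_word) \<Rightarrow> nat list \<Rightarrow> nat list
     \<Rightarrow> 'a partial_word" where
  "subst_product \<alpha> \<upsilon> k w ps ns = star_list (map2 (\<lambda>p n. subst_word \<alpha> \<upsilon> k p (w n)) ps ns)"

end

theory Submission
  imports Defs "HOL-Analysis.Function_Topology"
begin

text \<open>
  The words form a semigroup under \<open>(++)\<close>, and all the maps \<open>T\<^sub>p\<close> are homomorphisms that fix
  the constant words.  Consider the ultrafilters on words that contain, for every \<open>m\<close>, the set
  of words supported beyond \<open>m\<close>.  Those containing the constant words form a compact right
  topological semigroup, which has a minimal idempotent \<open>q\<close>.  If \<open>e = e q\<close> is an idempotent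
  containing the variable words, then \<open>u = q e\<close> is an idempotent with \<open>u q = q u = u\<close>.  Hence
  \<open>T\<^sub>p u\<close> is an idempotent below \<open>q\<close>, so \<open>T\<^sub>p u = q\<close> for all \<open>p \<ge> 1\<close> simultaneously.
  The colours are those that belong to \<open>u\<close> and \<open>q\<close>; the sequence is built as in the
  ultrafilter proof of Hindman's theorem, each \<open>w\<^bsub>n+1\<^esub>\<close> being taken from a member of \<open>u\<close>
  determined by the finitely many products of \<open>w\<^sub>1, \<dots>, w\<^sub>n\<close>.
\<close>

section \<open>Topology of function spaces\<close>

text \<open>Makes compact sets of ultrafilters closed: the carrier of the semigroup locale is a
  \<open>t2_space\<close>, and ultrafilters will be functions from sets to
  \<open>bool\<close>.\<close>

instance "fun" :: (type, t2_space) t2_space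
proof
  fix f g :: "'a \<Rightarrow> 'b"
  assume "f \<noteq> g"
  then obtain x where "f x \<noteq> g x" by blast
  then obtain U V where UV: "open U" "open V" "f x \<in> U" "g x \<in> V" "U \<inter> V = {}"
    by (meson hausdorff)
  have "continuous_on UNIV (\<lambda>h::'a \<Rightarrow> 'b. h x)" by simp
  then have "open ((\<lambda>h. h x) -` U)" "open ((\<lambda>h. h x) -` V)"
    using UV by (auto intro: open_vimage)
  then show "\<exists>U V. open U \<and> open V \<and> f \<in> U \<and> g \<in> V \<and> U \<inter> V = {}"
    using UV by (intro exI[of _ "(\<lambda>h. h x) -` U"] exI[of _ "(\<lambda>h. h x) -` V"]) auto
qed

text \<open>Tychonoff's theorem, transferred from \<open>product_topology\<close> to the topology of
  the function type.\<close>

lemma compact_UNIV_fun: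
  assumes "compact (UNIV :: 'b::topological_space set)"
  shows "compact (UNIV :: ('a \<Rightarrow> 'b) set)"
proof -
  have "compact_space (euclidean :: 'b topology)"
    using assms by (simp add: compact_space_def)
  then have "compact_space (product_topology (\<lambda>i::'a. euclidean :: 'b topology) UNIV)"
    by (simp add: compact_space_product_topology)
  then show ?thesis
    by (metis compact_space_def compactin_euclidean_iff euclidean_product_topology topspace_euclidean)
qed

section \<open>Idempotents in compact right topological semigroups\<close>

text \<open>Zorn's lemma, with the finite intersection property of compact sets keeping the
  intersection of a chain nonempty. The predicate \<open>P\<close> will be closure under products in
  one use and being a left ideal in the other.\<close>

lemma minimal_closed_set:
  fixes K :: "'b::t2_space set"
  assumes K: "compact K" "K \<noteq> {}" "P K"
    and Inter: "\<And>\<C>. \<C> \<noteq> {} \<Longrightarrow> (\<And>A. A \<in> \<C> \<Longrightarrow> P A) \<Longrightarrow> P (\<Inter>\<C>)"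
  obtains M where "compact M" "M \<noteq> {}" "M \<subseteq> K" "P M"
    "\<And>X. compact X \<Longrightarrow> X \<noteq> {} \<Longrightarrow> X \<subseteq> M \<Longrightarrow> P X \<Longrightarrow> X = M"
proof -
  define \<A> where "\<A> = {A. compact A \<and> A \<noteq> {} \<and> A \<subseteq> K \<and> P A}"
  \<comment> \<open>The Zorn rule yields maximal sets, so it is applied to complements.\<close>
  have "\<exists>M\<in>uminus ` \<A>. \<forall>X\<in>uminus ` \<A>. M \<subseteq> X \<longrightarrow> X = M"
  proof (rule subset_Zorn_nonempty)
    fix \<D> assume "\<D> \<noteq> {}" and chain: "subset.chain (uminus ` \<A>) \<D>"
    define \<C> where "\<C> = uminus ` \<D>"
    have ne: "\<C> \<noteq> {}" using \<open>\<D> \<noteq> {}\<close> by (simp add: \<C>_def)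
    have sub: "\<C> \<subseteq> \<A>" using chain by (auto simp: \<C>_def subset.chain_def)
    have lin: "A \<subseteq> B \<or> B \<subseteq> A" if "A \<in> \<C>" "B \<in> \<C>" for A B
    proof -
      have "- A \<in> \<D>" "- B \<in> \<D>" using that by (auto simp: \<C>_def)
      then have "- A \<subseteq> - B \<or> - B \<subseteq> - A" using chain unfolding subset_chain_def by blast
      then show ?thesis by auto
    qed
    have fin: "\<exists>A\<in>\<C>. A \<subseteq> \<Inter>\<B>" if "finite \<B>" "\<B> \<subseteq> \<C>" for \<B>
      using that
    proof induction
      case empty
      then show ?case using ne by auto
    next
      case (insert B \<B>)
      then obtain A where "A \<in> \<C>" "A \<subseteq> \<Inter>\<B>" by auto
      then show ?case using lin[of A B] insert.prems by auto
    qed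
    have "K \<inter> \<Inter>\<C> \<noteq> {}"
    proof (rule compact_imp_fip[OF K(1)])
      show "closed T" if "T \<in> \<C>" for T using that sub compact_imp_closed by (auto simp: \<A>_def)
    next
      fix \<B> assume "finite \<B>" "\<B> \<subseteq> \<C>"
      then obtain A where "A \<in> \<C>" "A \<subseteq> \<Inter>\<B>" using fin by blast
      moreover from this(1) have "A \<noteq> {}" "A \<subseteq> K" using sub by (auto simp: \<A>_def)
      ultimately show "K \<inter> \<Inter>\<B> \<noteq> {}" by blast
    qed
    moreover have "\<Inter>\<C> \<subseteq> K" using ne sub by (auto simp: \<A>_def)
    moreover have "closed (\<Inter>\<C>)"
      using sub compact_imp_closed by (intro closed_Inter) (auto simp: \<A>_def)
    moreover have "P (\<Inter>\<C>)" using ne sub by (intro Inter) (auto simp: \<A>_def)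
    moreover have "compact (\<Inter>\<C>)"
      using compact_Int_closed[OF K(1) \<open>closed (\<Inter>\<C>)\<close>] \<open>\<Inter>\<C> \<subseteq> K\<close> by (simp add: inf.absorb2)
    ultimately have "\<Inter>\<C> \<in> \<A>" by (auto simp: \<A>_def)
    moreover have "\<Union>\<D> = - \<Inter>\<C>" by (auto simp: \<C>_def)
    ultimately show "\<Union>\<D> \<in> uminus ` \<A>" by blast
  qed (use K in \<open>auto simp: \<A>_def\<close>)
  then obtain M where "M \<in> \<A>" and max: "\<And>X. X \<in> \<A> \<Longrightarrow> - M \<subseteq> - X \<Longrightarrow> - X = - M"
    by auto
  show thesis
  proof
    show "compact M" "M \<noteq> {}" "M \<subseteq> K" "P M" using \<open>M \<in> \<A>\<close> by (auto simp: \<A>_def)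
    show "X = M" if "compact X" "X \<noteq> {}" "X \<subseteq> M" "P X" for X
      using max[of X] that \<open>M \<in> \<A>\<close> by (auto simp: \<A>_def)
  qed
qed

locale right_topological_semigroup =
  fixes mult :: "'b::t2_space \<Rightarrow> 'b \<Rightarrow> 'b" (infixl "\<cdot>" 70)
  assumes assoc: "(x \<cdot> y) \<cdot> z = x \<cdot> (y \<cdot> z)"
    and continuous_mult: "continuous_on UNIV (\<lambda>x. x \<cdot> y)"
begin

lemma compact_translate: "compact A \<Longrightarrow> compact ((\<lambda>x. x \<cdot> y) ` A)"
  by (rule compact_continuous_image[OF continuous_on_subset[OF continuous_mult]]) auto

text \<open>For \<open>e\<close> in a minimal compact subsemigroup \<open>M\<close>, the compact
  subsemigroup \<open>M e\<close> equals \<open>M\<close>. So the closed subsemigroup of all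
  \<open>x\<close> in \<open>M\<close> with \<open>x e = e\<close> is nonempty, hence is all of
  \<open>M\<close>, and contains \<open>e\<close>.\<close>

theorem Ellis_Numakura:
  assumes K: "compact K" "K \<noteq> {}" "\<And>x y. x \<in> K \<Longrightarrow> y \<in> K \<Longrightarrow> x \<cdot> y \<in> K"
  obtains e where "e \<in> K" "e \<cdot> e = e"
proof -
  obtain M where M: "compact M" "M \<noteq> {}" "M \<subseteq> K" and closed: "\<forall>x\<in>M. \<forall>y\<in>M. x \<cdot> y \<in> M"
    and min: "\<And>X. compact X \<Longrightarrow> X \<noteq> {} \<Longrightarrow> X \<subseteq> M \<Longrightarrow> \<forall>x\<in>X. \<forall>y\<in>X. x \<cdot> y \<in> X \<Longrightarrow> X = M"
    by (rule minimal_closed_set[of K "\<lambda>A. \<forall>x\<in>A. \<forall>y\<in>A. x \<cdot> y \<in> A"]) (use K in auto)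
  then obtain e where e: "e \<in> M" by auto
  have "(\<lambda>x. x \<cdot> e) ` M = M"
  proof (rule min)
    have "(x \<cdot> e) \<cdot> (y \<cdot> e) = (x \<cdot> e \<cdot> y) \<cdot> e" for x y by (simp add: assoc)
    then show "\<forall>x\<in>(\<lambda>x. x \<cdot> e) ` M. \<forall>y\<in>(\<lambda>x. x \<cdot> e) ` M. x \<cdot> y \<in> (\<lambda>x. x \<cdot> e) ` M"
      using e closed by auto
  qed (use M e closed compact_translate in auto)
  then obtain x where x: "x \<in> M" "x \<cdot> e = e" using e by (metis imageE)
  have "M \<inter> (\<lambda>x. x \<cdot> e) -` {e} = M"
  proof (rule min)
    have "closed ((\<lambda>x. x \<cdot> e) -` {e})"
      by (rule closed_vimage[OF closed_singleton continuous_mult])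
    then show "compact (M \<inter> (\<lambda>x. x \<cdot> e) -` {e})" using M(1) by (rule compact_Int_closed[rotated])
    show "M \<inter> (\<lambda>x. x \<cdot> e) -` {e} \<noteq> {}" using x by auto
    show "\<forall>x\<in>M \<inter> (\<lambda>x. x \<cdot> e) -` {e}. \<forall>y\<in>M \<inter> (\<lambda>x. x \<cdot> e) -` {e}. x \<cdot> y \<in> M \<inter> (\<lambda>x. x \<cdot> e) -` {e}"
      using closed by (auto simp: assoc)
  qed auto
  then have "e \<cdot> e = e" using e by blast
  then show thesis using that e \<open>M \<subseteq> K\<close> by blast
qed

text \<open>The idempotent is taken in a minimal compact left ideal \<open>L\<close>. An idempotent
  \<open>x\<close> of \<open>K\<close> below \<open>e\<close> lies in \<open>L\<close>, so
  \<open>K x = L\<close> contains \<open>e\<close>; from \<open>e = y x\<close> follows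
  \<open>e x = e\<close>, while \<open>e x = x\<close>.\<close>

theorem minimal_idempotent:
  assumes K: "compact K" "K \<noteq> {}" "\<And>x y. x \<in> K \<Longrightarrow> y \<in> K \<Longrightarrow> x \<cdot> y \<in> K"
  obtains e where "e \<in> K" "e \<cdot> e = e"
    "\<And>x. x \<in> K \<Longrightarrow> x \<cdot> x = x \<Longrightarrow> x \<cdot> e = x \<Longrightarrow> e \<cdot> x = x \<Longrightarrow> x = e"
proof -
  obtain L where L: "compact L" "L \<noteq> {}" "L \<subseteq> K" and ideal: "\<forall>x\<in>K. \<forall>y\<in>L. x \<cdot> y \<in> L"
    and min: "\<And>X. compact X \<Longrightarrow> X \<noteq> {} \<Longrightarrow> X \<subseteq> L \<Longrightarrow> \<forall>x\<in>K. \<forall>y\<in>X. x \<cdot> y \<in> X \<Longrightarrow> X = L"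
    by (rule minimal_closed_set[of K "\<lambda>A. \<forall>x\<in>K. \<forall>y\<in>A. x \<cdot> y \<in> A"]) (use K in auto)
  obtain e where e: "e \<in> L" "e \<cdot> e = e"
    by (rule Ellis_Numakura[of L]) (use L ideal in auto)
  show thesis
  proof
    show "e \<in> K" "e \<cdot> e = e" using e L by auto
    fix x assume x: "x \<in> K" "x \<cdot> x = x" "x \<cdot> e = x" "e \<cdot> x = x"
    have "x \<in> L" using ideal x(1,3) e(1) by metis
    have "(\<lambda>y. y \<cdot> x) ` K = L"
    proof (rule min)
      show "\<forall>a\<in>K. \<forall>y\<in>(\<lambda>y. y \<cdot> x) ` K. a \<cdot> y \<in> (\<lambda>y. y \<cdot> x) ` K"
        using K(3) by (auto simp flip: assoc)
    qed (use K ideal \<open>x \<in> L\<close> compact_translate in auto)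
    then obtain y where "e = y \<cdot> x" using e(1) by blast
    then have "e \<cdot> x = e" using x(2) by (simp add: assoc)
    then show "x = e" using x(4) by simp
  qed
qed

end

section \<open>The compact space of ultrafilters\<close>

text \<open>
  Ultrafilters are represented by their characteristic functions, so that their space is a closed
  subset of the product space \<open>'s set \<Rightarrow> bool\<close>.
\<close>

definition ultra :: "('s set \<Rightarrow> bool) \<Rightarrow> bool" where
  "ultra p \<longleftrightarrow> (\<forall>A. p (- A) = (\<not> p A)) \<and> (\<forall>A B. p (A \<inter> B) = (p A \<and> p B))"

lemma ultra_Compl: "ultra p \<Longrightarrow> p (- A) = (\<not> p A)"
  and ultra_Int: "ultra p \<Longrightarrow> p (A \<inter> B) = (p A \<and> p B)"
  by (auto simp: ultra_def)

lemma ultra_mono: "ultra p \<Longrightarrow> p A \<Longrightarrow> A \<subseteq> B \<Longrightarrow> p B"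
  using ultra_Int[of p A B] by (simp add: inf.absorb1)

lemma ultra_UNIV: "ultra p \<Longrightarrow> p UNIV"
  using ultra_Compl[of p UNIV] ultra_mono[of p "{}" UNIV] by auto

lemma ultra_empty: "ultra p \<Longrightarrow> \<not> p {}"
  using ultra_Compl[of p UNIV] ultra_UNIV[of p] by simp

lemma ultra_Un: "ultra p \<Longrightarrow> p (A \<union> B) = (p A \<or> p B)"
  using ultra_Compl[of p "A \<union> B"] ultra_Compl[of p A] ultra_Compl[of p B] ultra_Int[of p "- A" "- B"]
  by auto

lemma ultra_finite_UN:
  assumes "ultra p"
  shows "finite I \<Longrightarrow> p (\<Union>i\<in>I. A i) \<Longrightarrow> \<exists>i\<in>I. p (A i)"
  by (induction I rule: finite_induct) (auto simp: ultra_empty[OF assms] ultra_Un[OF assms])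

lemma ultra_finite_INT:
  assumes "ultra p"
  shows "finite I \<Longrightarrow> (\<And>i. i \<in> I \<Longrightarrow> p (A i)) \<Longrightarrow> p (\<Inter>i\<in>I. A i)"
  by (induction I rule: finite_induct) (auto simp: ultra_UNIV[OF assms] ultra_Int[OF assms])

lemma ultra_Collect_conj:
  "ultra p \<Longrightarrow> p {x. P x \<and> Q x} = (p {x. P x} \<and> p {x. Q x})"
  using ultra_Int[of p "{x. P x}" "{x. Q x}"] by (simp add: Int_def)

lemma ultra_Collect_not: "ultra p \<Longrightarrow> p {x. \<not> P x} = (\<not> p {x. P x})"
  using ultra_Compl[of p "{x. P x}"] by (simp add: Compl_eq)

lemma ultra_principal: "ultra (\<lambda>A. x \<in> A)"
  by (simp add: ultra_def)

lemma closed_coordinate: "closed {p :: 's \<Rightarrow> bool. p A}"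
  and open_coordinate: "open {p :: 's \<Rightarrow> bool. p A}"
proof -
  have "continuous_on UNIV (\<lambda>p::'s \<Rightarrow> bool. p A)" by simp
  then have "open ((\<lambda>p::'s \<Rightarrow> bool. p A) -` {True})" "open ((\<lambda>p::'s \<Rightarrow> bool. p A) -` {False})"
    by (auto intro: open_vimage open_discrete)
  then show "closed {p :: 's \<Rightarrow> bool. p A}" "open {p :: 's \<Rightarrow> bool. p A}"
    by (auto simp: vimage_def closed_def Compl_eq)
qed

text \<open>Each defining condition involves finitely many coordinates, and every coordinate
  condition is clopen.\<close>

lemma closed_ultra: "closed {p :: 's set \<Rightarrow> bool. ultra p}"
proof -
  \<comment> \<open>Equivalences are split into implications, which are closed conditions when the
    premise is open and the conclusion closed.\<close>
  have *: "(a = (\<not> b)) = ((a \<longrightarrow> \<not> b) \<and> (\<not> b \<longrightarrow> a))"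
    "(a = (b \<and> c)) = ((a \<longrightarrow> b \<and> c) \<and> (b \<and> c \<longrightarrow> a))" for a b c by auto
  show ?thesis
    unfolding ultra_def *
    by (intro closed_Collect_conj closed_Collect_all closed_Collect_imp open_Collect_neg
        closed_Collect_neg open_Collect_conj closed_coordinate open_coordinate)
qed

lemma compact_ultra: "compact {p :: 's set \<Rightarrow> bool. ultra p}"
proof -
  have "compact (UNIV :: ('s set \<Rightarrow> bool) set)"
    by (intro compact_UNIV_fun finite_imp_compact) auto
  from compact_Int_closed[OF this closed_ultra] show ?thesis by simp
qed

lemma compact_ultra_INT: "compact ({p :: 's set \<Rightarrow> bool. ultra p} \<inter> (\<Inter>i. {p. p (B i)}))"
  by (intro compact_Int_closed compact_ultra closed_INT ballI closed_coordinate)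

text \<open>By monotonicity finitely many of the sets have a common point, whose principal
  ultrafilter contains them; compactness does the rest.\<close>

lemma ultra_exists:
  fixes B :: "nat \<Rightarrow> 's set"
  assumes "decseq B" "\<And>i. B i \<noteq> {}"
  obtains p where "ultra p" "\<And>i. p (B i)"
proof -
  let ?U = "{p :: 's set \<Rightarrow> bool. ultra p}"
  have "?U \<inter> \<Inter>((\<lambda>i. {p. p (B i)}) ` UNIV) \<noteq> {}"
  proof (rule compact_imp_fip_image)
    show "compact ?U" by (rule compact_ultra)
    show "?U \<inter> \<Inter>((\<lambda>i. {p. p (B i)}) ` I) \<noteq> {}" if "finite I" "I \<subseteq> UNIV" for I
    proof -
      \<comment> \<open>\<open>insert 0\<close> keeps \<open>Max\<close> meaningful for empty
        \<open>I\<close>.\<close>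
      obtain x where "x \<in> B (Max (insert 0 I))" using assms(2) by blast
      then have "x \<in> B i" if "i \<in> I" for i
        using that \<open>finite I\<close> decseqD[OF assms(1), of i "Max (insert 0 I)"] by auto
      then have "(\<lambda>A. x \<in> A) \<in> ?U \<inter> \<Inter>((\<lambda>i. {p. p (B i)}) ` I)" 
        by (simp add: ultra_principal)
      then show ?thesis by blast
    qed
  qed (rule closed_coordinate)
  then show thesis using that by blast
qed

section \<open>Images and products of ultrafilters\<close>

definition ultra_map :: "('s \<Rightarrow> 't) \<Rightarrow> ('s set \<Rightarrow> bool) \<Rightarrow> 't set \<Rightarrow> bool" where
  "ultra_map f p A = p (f -` A)"

lemma ultra_ultra_map: "ultra p \<Longrightarrow> ultra (ultra_map f p)"
  by (simp add: ultra_def ultra_map_def vimage_Compl)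

lemma ultra_map_id_on:
  assumes "ultra p" "p B" "\<And>x. x \<in> B \<Longrightarrow> f x = x"
  shows "ultra_map f p = p"
proof
  fix A
  have "p (f -` A) = p (f -` A \<inter> B)" "p A = p (A \<inter> B)"
    using assms(2) by (simp_all add: ultra_Int[OF assms(1)])
  moreover have "f -` A \<inter> B = A \<inter> B" using assms(3) by auto
  ultimately show "ultra_map f p A = p A" by (simp add: ultra_map_def)
qed

text \<open>The extension of \<open>f\<close> to ultrafilters, with the left factor quantified
  outermost.\<close>

definition ultra_mult :: "('s \<Rightarrow> 's \<Rightarrow> 's) \<Rightarrow> ('s set \<Rightarrow> bool) \<Rightarrow> ('s set \<Rightarrow> bool) \<Rightarrow> 's set \<Rightarrow> bool" where
  "ultra_mult f p q A = p {x. q {y. f x y \<in> A}}"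

lemma ultra_ultra_mult:
  assumes "ultra p" "ultra q"
  shows "ultra (ultra_mult f p q)"
  unfolding ultra_def ultra_mult_def
  by (simp add: ultra_Collect_conj[OF assms(1)] ultra_Collect_conj[OF assms(2)]
      ultra_Collect_not[OF assms(1)] ultra_Collect_not[OF assms(2)])

lemma ultra_mult_assoc:
  assumes "\<And>x y z. f (f x y) z = f x (f y z)"
  shows "ultra_mult f (ultra_mult f p q) r = ultra_mult f p (ultra_mult f q r)"
  by (simp add: ultra_mult_def fun_eq_iff assms)

text \<open>For fixed \<open>q\<close> and \<open>A\<close>, the value of
  \<open>ultra_mult f p q\<close> at \<open>A\<close> is a single coordinate of \<open>p\<close>;
  hence continuity in the left factor.\<close>

lemma right_topological_semigroup_ultra_mult:
  assumes "\<And>x y z. f (f x y) z = f x (f y z)"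
  shows "right_topological_semigroup (ultra_mult f)"
proof
  show "ultra_mult f (ultra_mult f p q) r = ultra_mult f p (ultra_mult f q r)" for p q r
    by (rule ultra_mult_assoc[OF assms])
  show "continuous_on UNIV (\<lambda>p. ultra_mult f p q)" for q
    unfolding ultra_mult_def
    by (intro continuous_on_coordinatewise_then_product continuous_on_product_coordinates)
qed

lemma ultra_map_mult:
  assumes "\<And>x y. h (f x y) = f (h x) (h y)"
  shows "ultra_map h (ultra_mult f p q) = ultra_mult f (ultra_map h p) (ultra_map h q)"
  by (rule ext) (simp add: ultra_map_def ultra_mult_def vimage_def assms)


section \<open>Ultrafilters of words with supports tending to infinity\<close>

text \<open>The tail condition lets \<open>++\<close> stand in for the partial operation: for a
  fixed word \<open>x\<close>, almost every right factor lies beyond \<open>x\<close>.\<close>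

definition tail_ultra :: "'a partial_word set \<Rightarrow> ('a partial_word set \<Rightarrow> bool) set" where
  "tail_ultra X = {p. ultra p} \<inter> (\<Inter>m. {p. p (X \<inter> {w. dom w \<subseteq> {m<..}})})"

lemma tail_ultraD:
  assumes "p \<in> tail_ultra X"
  shows "ultra p" "p (X \<inter> {w. dom w \<subseteq> {m<..}})" "p X"
proof -
  show *: "ultra p" "p (X \<inter> {w. dom w \<subseteq> {m<..}})" for m
    using assms by (auto simp: tail_ultra_def)
  show "p X" by (rule ultra_mono[OF *]) simp
qed

lemma compact_tail_ultra: "compact (tail_ultra X)"
  unfolding tail_ultra_def by (rule compact_ultra_INT)

lemma tail_ultra_nonempty:
  assumes "\<And>m. X \<inter> {w. dom w \<subseteq> {m<..}} \<noteq> {}"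
  shows "tail_ultra X \<noteq> {}"
proof -
  have "decseq (\<lambda>m. X \<inter> {w. dom w \<subseteq> {m<..}})"
    by (intro decseq_SucI Int_mono subset_refl Collect_mono impI) (erule subset_trans, auto)
  then obtain p where "ultra p" "\<And>m. p (X \<inter> {w. dom w \<subseteq> {m<..}})"
    by (rule ultra_exists[OF _ assms]) (rule that; assumption)
  then show ?thesis by (auto simp: tail_ultra_def)
qed

text \<open>The hypothesis asks for \<open>x ++ y\<close> in \<open>Z\<close> only when
  \<open>y\<close> lies far enough out, depending on \<open>x\<close>; this holds for
  \<open>q\<close>-almost every \<open>y\<close>.\<close>

lemma tail_ultra_mult:
  assumes p: "p \<in> tail_ultra X" and q: "q \<in> tail_ultra Y"
    and XY: "\<And>x. x \<in> X \<Longrightarrow> \<exists>m. \<forall>y\<in>Y. dom y \<subseteq> {m<..} \<longrightarrow> x ++ y \<in> Z"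
  shows "ultra_mult (++) p q \<in> tail_ultra Z"
proof -
  note p = tail_ultraD[OF p] and q = tail_ultraD[OF q]
  have "ultra_mult (++) p q (Z \<inter> {w. dom w \<subseteq> {m<..}})" for m
    unfolding ultra_mult_def
  proof (rule ultra_mono[OF p(1) p(2)[of m]], safe)
    fix x assume x: "x \<in> X" "dom x \<subseteq> {m<..}"
    then obtain l where l: "\<And>y. y \<in> Y \<Longrightarrow> dom y \<subseteq> {l<..} \<Longrightarrow> x ++ y \<in> Z" using XY by blast
    \<comment> \<open>The bound \<open>l\<close> puts the product into \<open>Z\<close>, the bound
      \<open>m\<close> keeps its domain in the tail.\<close>
    have "Y \<inter> {y. dom y \<subseteq> {max l m<..}} \<subseteq> {y. x ++ y \<in> Z \<inter> {w. dom w \<subseteq> {m<..}}}"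
    proof
      fix y assume y: "y \<in> Y \<inter> {y. dom y \<subseteq> {max l m<..}}"
      then have "dom y \<subseteq> {l<..}" "dom y \<subseteq> {m<..}" by auto
      then have "x ++ y \<in> Z" "dom (x ++ y) \<subseteq> {m<..}" using l y x(2) by auto
      then show "y \<in> {y. x ++ y \<in> Z \<inter> {w. dom w \<subseteq> {m<..}}}" by blast
    qed
    then show "q {y. x ++ y \<in> Z \<inter> {w. dom w \<subseteq> {m<..}}}" by (rule ultra_mono[OF q(1) q(2)])
  qed
  then show ?thesis using ultra_ultra_mult[OF p(1) q(1)] by (simp add: tail_ultra_def)
qed

lemma tail_ultra_map:
  assumes p: "p \<in> tail_ultra X" and f: "\<And>x. x \<in> X \<Longrightarrow> f x \<in> Y" "\<And>x. dom (f x) = dom x"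
  shows "ultra_map f p \<in> tail_ultra Y"
proof -
  note p = tail_ultraD[OF p]
  have "ultra_map f p (Y \<inter> {w. dom w \<subseteq> {m<..}})" for m
    unfolding ultra_map_def by (rule ultra_mono[OF p(1) p(2)[of m]]) (use f in auto)
  then show ?thesis using ultra_ultra_map[OF p(1)] by (simp add: tail_ultra_def)
qed

section \<open>Concatenation and substitution of words\<close>

lemma const_words_add:
  assumes "x \<in> const_words \<alpha> k" "y \<in> const_words \<alpha> k"
  shows "x ++ y \<in> const_words \<alpha> k"
proof -
  have "the ((x ++ y) n) \<in> \<alpha> ` {1..k n}" if "n \<in> dom y \<union> dom x" for n
    using that assms by (cases "n \<in> dom y") (auto simp: const_words_def map_add_dom_app_simps)
  then have "\<forall>n\<in>dom (x ++ y). the ((x ++ y) n) \<in> \<alpha> ` {1..k n}" by simp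
  then show ?thesis using assms by (simp add: const_words_def)
qed

text \<open>The right argument of \<open>++\<close> prevails, so an occurrence of \<upsilon> in
  \<open>y\<close> survives any overlap.\<close>

lemma var_words_add_right:
  assumes "x \<in> const_words \<alpha> k \<union> var_words \<alpha> \<upsilon> k" "y \<in> var_words \<alpha> \<upsilon> k"
  shows "x ++ y \<in> var_words \<alpha> \<upsilon> k"
proof -
  have x: "finite (dom x)" "dom x \<subseteq> {1..}" "\<And>n. n \<in> dom x \<Longrightarrow> the (x n) \<in> insert \<upsilon> (\<alpha> ` {1..k n})"
    using assms(1) by (auto simp: const_words_def var_words_def)
  have y: "finite (dom y)" "dom y \<subseteq> {1..}" "\<And>n. n \<in> dom y \<Longrightarrow> the (y n) \<in> insert \<upsilon> (\<alpha> ` {1..k n})"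
    using assms(2) by (auto simp: var_words_def)
  obtain n where n: "n \<in> dom y" "the (y n) = \<upsilon>" using assms(2) by (auto simp: var_words_def)
  have "the ((x ++ y) n) \<in> insert \<upsilon> (\<alpha> ` {1..k n})" if "n \<in> dom (x ++ y)" for n
    using that x(3)[of n] y(3)[of n] by (cases "n \<in> dom y") (auto simp: map_add_dom_app_simps)
  moreover have "the ((x ++ y) n) = \<upsilon>" "n \<in> dom (x ++ y)"
    using n by (auto simp: map_add_dom_app_simps)
  ultimately show ?thesis
    unfolding var_words_def using x(1,2) y(1,2)
    by (intro CollectI conjI ballI bexI[of _ n]) auto
qed

text \<open>A variable of \<open>x\<close> could be overwritten by \<open>y\<close>, hence the
  disjoint domains; on these \<open>++\<close> commutes.\<close>

lemma var_words_add_left: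
  assumes "x \<in> var_words \<alpha> \<upsilon> k" "y \<in> const_words \<alpha> k \<union> var_words \<alpha> \<upsilon> k" "dom x \<inter> dom y = {}"
  shows "x ++ y \<in> var_words \<alpha> \<upsilon> k"
  using var_words_add_right[OF assms(2,1)] map_add_comm[OF assms(3)] by simp

lemma dom_subst_word [simp]: "dom (subst_word \<alpha> \<upsilon> k p w) = dom w"
  by (auto simp: subst_word_def dom_def)

text \<open>Substitution acts on each position separately, so it commutes with overriding even on
  overlapping domains.\<close>

lemma subst_word_add:
  "subst_word \<alpha> \<upsilon> k p (x ++ y) = subst_word \<alpha> \<upsilon> k p x ++ subst_word \<alpha> \<upsilon> k p y"
proof
  fix n
  show "subst_word \<alpha> \<upsilon> k p (x ++ y) n = (subst_word \<alpha> \<upsilon> k p x ++ subst_word \<alpha> \<upsilon> k p y) n"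
    by (cases "y n") (simp_all add: subst_word_def map_add_def)
qed

lemma subst_word_const:
  assumes "\<upsilon> \<notin> \<alpha> ` {1..}" "w \<in> const_words \<alpha> k"
  shows "subst_word \<alpha> \<upsilon> k p w = w"
proof
  fix n
  show "subst_word \<alpha> \<upsilon> k p w n = w n"
  proof (cases "w n")
    case (Some a)
    then have "n \<in> dom w" "the (w n) = a" by auto
    then have "a \<in> \<alpha> ` {1..k n}" using assms(2) unfolding const_words_def by blast
    then have "a \<noteq> \<upsilon>" using assms(1) by auto
    then show ?thesis using Some by (simp add: subst_word_def)
  qed (simp add: subst_word_def)
qed

lemma subst_word_var:
  assumes k: "\<forall>n\<ge>1. k n \<ge> 1" and p: "p \<noteq> 0" and w: "w \<in> var_words \<alpha> \<upsilon> k"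
  shows "subst_word \<alpha> \<upsilon> k p w \<in> const_words \<alpha> k"
proof -
  have "the (subst_word \<alpha> \<upsilon> k p w n) \<in> \<alpha> ` {1..k n}" if "n \<in> dom w" for n
  proof -
    from that obtain a where a: "w n = Some a" by auto
    have "the (w n) \<in> insert \<upsilon> (\<alpha> ` {1..k n})" "n \<in> {1..}"
      using w that unfolding var_words_def by blast+
    then have "a \<in> insert \<upsilon> (\<alpha> ` {1..k n})" "k n \<ge> 1" using k a by auto
    moreover have "(if p \<le> k n then \<alpha> p else \<alpha> (k n)) \<in> \<alpha> ` {1..k n}"
      using p \<open>k n \<ge> 1\<close> by simp
    ultimately show ?thesis using p by (cases "a = \<upsilon>") (simp_all add: subst_word_def a)
  qed
  then show ?thesis using w unfolding const_words_def var_words_def by (simp del: dom_eq_empty_conv)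
qed

section \<open>The idempotents for constant and variable words\<close>

interpretation words: right_topological_semigroup "ultra_mult ((++) :: 'a partial_word \<Rightarrow> _)"
  by (rule right_topological_semigroup_ultra_mult) simp

text \<open>
  \<open>W True\<close> and \<open>W False\<close> are the idempotents \<open>u\<close> and \<open>q\<close>; the index records whether the variable
  occurs, which makes \<open>W\<close> a homomorphism from \<open>(bool, \<or>)\<close>.
\<close>

lemma idempotents_exist:
  fixes \<alpha> :: "nat \<Rightarrow> 'a"
  assumes \<upsilon>: "\<upsilon> \<notin> \<alpha> ` {1..}" and k: "\<forall>n\<ge>1. k n \<ge> 1"
  obtains W where "W True \<in> tail_ultra (var_words \<alpha> \<upsilon> k)" "W False \<in> tail_ultra (const_words \<alpha> k)"
    "\<And>b c. ultra_mult (++) (W b) (W c) = W (b \<or> c)"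
    "\<And>p. ultra_map (subst_word \<alpha> \<upsilon> k p) (W True) = W (p = 0)"
proof -
  let ?c = "const_words \<alpha> k" and ?v = "var_words \<alpha> \<upsilon> k" and ?T = "subst_word \<alpha> \<upsilon> k"
  let ?C = "tail_ultra ?c" and ?V = "tail_ultra ?v"
  let ?m = "ultra_mult ((++) :: 'a partial_word \<Rightarrow> _)"
  \<comment> \<open>Beyond \<open>Max (dom x)\<close> the domains are disjoint, so the variable of
    \<open>x\<close> is not overwritten.\<close>
  have disj: "\<exists>m. \<forall>y\<in>Y. dom y \<subseteq> {m<..} \<longrightarrow> x ++ y \<in> ?v" if "x \<in> ?v" "Y \<subseteq> ?c \<union> ?v" for x Y
  proof -
    have "finite (dom x)" using that(1) by (simp add: var_words_def)
    then have "dom x \<subseteq> {..Max (dom x)}" by (meson Max_ge atMost_iff subsetI)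
    then have "dom x \<inter> dom y = {}" if "dom y \<subseteq> {Max (dom x)<..}" for y :: "'a partial_word"
      using that by fastforce
    then show ?thesis using var_words_add_left[OF that(1)] that(2) by (meson subsetD)
  qed
  have CC: "?m p q \<in> ?C" if "p \<in> ?C" "q \<in> ?C" for p q
    using that by (rule tail_ultra_mult) (blast intro: const_words_add)
  have CV: "?m p q \<in> ?V" if "p \<in> ?C" "q \<in> ?V" for p q
    using that by (rule tail_ultra_mult) (blast intro: var_words_add_right)
  have VC: "?m p q \<in> ?V" if "p \<in> ?V" "q \<in> ?C" for p q
    using that by (rule tail_ultra_mult) (rule disj, auto)
  have VV: "?m p q \<in> ?V" if "p \<in> ?V" "q \<in> ?V" for p q
    using that by (rule tail_ultra_mult) (rule disj, auto)
  have "[Suc m \<mapsto> \<alpha> 1] \<in> ?c \<inter> {w. dom w \<subseteq> {m<..}}" for m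
    using k by (auto simp: const_words_def)
  then have C_ne: "?C \<noteq> {}" by (intro tail_ultra_nonempty) blast
  have "[Suc m \<mapsto> \<upsilon>] \<in> ?v \<inter> {w. dom w \<subseteq> {m<..}}" for m
    by (auto simp: var_words_def)
  then have V_ne: "?V \<noteq> {}" by (intro tail_ultra_nonempty) blast
  obtain q where q: "q \<in> ?C" "?m q q = q"
    and min: "\<And>x. x \<in> ?C \<Longrightarrow> ?m x x = x \<Longrightarrow> ?m x q = x \<Longrightarrow> ?m q x = x \<Longrightarrow> x = q"
    by (rule words.minimal_idempotent[OF compact_tail_ultra C_ne CC]) auto
  \<comment> \<open>Searching among the products \<open>x q\<close> with \<open>x\<close> in
    \<open>?V\<close> makes \<open>e q = e\<close> automatic, as \<open>q\<close> is
    idempotent.\<close>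
  obtain e where e: "e \<in> (\<lambda>x. ?m x q) ` ?V" "?m e e = e"
  proof (rule words.Ellis_Numakura)
    show "compact ((\<lambda>x. ?m x q) ` ?V)" by (rule words.compact_translate[OF compact_tail_ultra])
    show "?m x y \<in> (\<lambda>x. ?m x q) ` ?V" if "x \<in> (\<lambda>x. ?m x q) ` ?V" "y \<in> (\<lambda>x. ?m x q) ` ?V" for x y
    proof -
      from that obtain a b where "x = ?m a q" "y = ?m b q" "a \<in> ?V" "b \<in> ?V" by auto
      moreover from this have "?m a (?m q b) \<in> ?V" using VV CV q(1) by simp
      moreover have "?m (?m a q) (?m b q) = ?m (?m a (?m q b)) q" by (simp only: words.assoc)
      ultimately show ?thesis by auto
    qed
  qed (use V_ne in auto)
  have "e \<in> ?V" "?m e q = e" using e(1) VC q by (auto simp: words.assoc)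
  define u where "u = ?m q e"
  have u: "u \<in> ?V" using CV q(1) \<open>e \<in> ?V\<close> by (simp add: u_def)
  have "?m u q = u" using \<open>?m e q = e\<close> by (simp add: u_def words.assoc)
  have "?m q u = u" using q(2) by (simp add: u_def flip: words.assoc)
  \<comment> \<open>Idempotence of \<open>u\<close> is the computation
    \<open>u u = (u q) e = u e = u\<close>.\<close>
  have "?m u e = u" using e(2) by (simp add: u_def words.assoc)
  moreover have "?m u u = ?m (?m u q) e" by (simp only: u_def words.assoc)
  ultimately have "?m u u = u" using \<open>?m u q = u\<close> by simp
  have T: "ultra_map (?T p) u = q" if "p \<noteq> 0" for p
  proof (rule min)
    have hom: "ultra_map (?T p) (?m x y) = ?m (ultra_map (?T p) x) (ultra_map (?T p) y)" for x y
      by (rule ultra_map_mult) (rule subst_word_add)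
    \<comment> \<open>The constant words belong to \<open>q\<close> and are fixed by
      \<open>?T p\<close>.\<close>
    have "ultra_map (?T p) q = q"
      by (rule ultra_map_id_on[OF tail_ultraD(1,3)[OF q(1)]]) (rule subst_word_const[OF \<upsilon>])
    then show "?m (ultra_map (?T p) u) (ultra_map (?T p) u) = ultra_map (?T p) u"
      "?m (ultra_map (?T p) u) q = ultra_map (?T p) u"
      "?m q (ultra_map (?T p) u) = ultra_map (?T p) u"
      using hom[of u u] hom[of u q] hom[of q u] \<open>?m u u = u\<close> \<open>?m u q = u\<close> \<open>?m q u = u\<close> by simp_all
    show "ultra_map (?T p) u \<in> ?C"
      by (rule tail_ultra_map[OF u]) (use subst_word_var[OF k that] in auto)
  qed
  have T0: "ultra_map (?T 0) u = u" by (simp add: ultra_map_def subst_word_def fun_eq_iff vimage_def)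
  show thesis
  proof (rule that[of "\<lambda>b. if b then u else q"])
    show "ultra_map (?T p) (if True then u else q) = (if p = 0 then u else q)" for p
      using T T0 by simp
  qed (use u q \<open>?m u u = u\<close> \<open>?m u q = u\<close> \<open>?m q u = u\<close> in auto)
qed

section \<open>Construction of the sequence of words\<close>

lemma star_list_snoc: "star_list (ws @ [w]) = star_list ws ++ w"
  by (induction ws) (simp_all add: star_list_def)

lemma subst_product_snoc:
  "length ps = length ns \<Longrightarrow>
    subst_product \<alpha> \<upsilon> k w (ps @ [p]) (ns @ [n]) = subst_product \<alpha> \<upsilon> k w ps ns ++ subst_word \<alpha> \<upsilon> k p (w n)"
  by (simp add: subst_product_def star_list_snoc)

text \<open>The Galvin-Glazer argument, run for both idempotents at once: the tag of a product,
  telling whether the variable occurs, selects the ultrafilter \<open>W b\<close> and the target set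
  \<open>D b\<close>.\<close>

lemma word_sequence_exists:
  fixes \<alpha> :: "nat \<Rightarrow> 'a"
  assumes W: "W True \<in> tail_ultra (var_words \<alpha> \<upsilon> k)" "W False \<in> tail_ultra (const_words \<alpha> k)"
    and mult: "\<And>b c. ultra_mult (++) (W b) (W c) = W (b \<or> c)"
    and T: "\<And>p. ultra_map (subst_word \<alpha> \<upsilon> k p) (W True) = W (p = 0)"
    and D: "\<And>b. W b (D b)"
  obtains w where "\<And>n. w n \<in> var_words \<alpha> \<upsilon> k" "\<And>n. word_less (w n) (w (Suc n))"
    "\<And>ps ns. ns \<noteq> [] \<Longrightarrow> list_all2 (\<lambda>p n. p \<le> k n) ps ns \<Longrightarrow> set ns \<subseteq> {1..} \<Longrightarrow> sorted_wrt (<) ns \<Longrightarrow>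
      subst_product \<alpha> \<upsilon> k w ps ns \<in> D (0 \<in> set ps)"
proof -
  let ?T = "subst_word \<alpha> \<upsilon> k"
  have ultra: "ultra (W b)" for b using W by (cases b) (auto dest: tail_ultraD)
  \<comment> \<open>A product in \<open>G b\<close> can be extended to the right by almost every word; by idempotence almost
    every extension is again in \<open>G\<close>, so the construction never gets stuck.\<close>
  define G where "G b = {x. \<forall>c. W c {y. x ++ y \<in> D (b \<or> c)}}" for b
  have G: "W c {y. x ++ y \<in> D (b \<or> c) \<inter> G (b \<or> c)}" if "x \<in> G b" for x b c
  proof -
    have "W c {y. W d {z. (x ++ y) ++ z \<in> D ((b \<or> c) \<or> d)}}" for d
    proof -
      \<comment> \<open>By \<open>mult\<close>, one condition for \<open>W (c \<or> d)\<close>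
        becomes an iterated one for \<open>W c\<close> and \<open>W d\<close>; this is where
        idempotence enters.\<close>
      have "W (c \<or> d) {y. x ++ y \<in> D (b \<or> (c \<or> d))}" using that by (simp add: G_def)
      then show ?thesis unfolding mult[symmetric] by (simp add: ultra_mult_def)
    qed
    moreover have "W c {y. x ++ y \<in> D (b \<or> c)}" using that by (simp add: G_def)
    moreover have "{y. x ++ y \<in> D (b \<or> c) \<inter> G (b \<or> c)} = {y. x ++ y \<in> D (b \<or> c)} \<inter>
        ({y. W True {z. (x ++ y) ++ z \<in> D ((b \<or> c) \<or> True)}} \<inter>
         {y. W False {z. (x ++ y) ++ z \<in> D ((b \<or> c) \<or> False)}})"
      unfolding G_def all_bool_eq by blast
    ultimately show ?thesis by (simp only: ultra_Int[OF ultra])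
  qed
  \<comment> \<open>Only finitely many conditions are imposed on \<open>v\<close>. Each belongs to
    \<open>W True\<close>, because \<open>?T p\<close> carries \<open>W True\<close> to
    \<open>W (p = 0)\<close>; the tail sets in \<open>W True\<close> provide
    \<open>word_less u v\<close>.\<close>
  have step: "\<exists>v\<in>var_words \<alpha> \<upsilon> k. word_less u v \<and>
      (\<forall>(b, x)\<in>F. \<forall>p\<le>N. x ++ ?T p v \<in> D (b \<or> p = 0) \<inter> G (b \<or> p = 0))"
    if F: "finite F" "\<forall>(b, x)\<in>F. x \<in> G b" for u :: "'a partial_word" and F and N :: nat
  proof -
    let ?B = "\<lambda>((b, x), p). {v. x ++ ?T p v \<in> D (b \<or> p = 0) \<inter> G (b \<or> p = 0)}"
    have "W True (?B i)" if "i \<in> F \<times> {..N}" for i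
    proof -
      from that F(2) obtain b x p where i: "i = ((b, x), p)" "x \<in> G b" by auto
      have "ultra_map (?T p) (W True) {y. x ++ y \<in> D (b \<or> p = 0) \<inter> G (b \<or> p = 0)}"
        unfolding T by (rule G[OF i(2)])
      then show ?thesis by (simp add: i ultra_map_def vimage_def)
    qed
    then have "W True (\<Inter>i\<in>F \<times> {..N}. ?B i)" by (intro ultra_finite_INT[OF ultra]) (use F in auto)
    then have "W True ((var_words \<alpha> \<upsilon> k \<inter> {w. dom w \<subseteq> {Max (dom u)<..}}) \<inter> (\<Inter>i\<in>F \<times> {..N}. ?B i))"
      (is "W True ?X")
      using tail_ultraD(2)[OF W(1)] ultra_Int[OF ultra] by blast
    then obtain v where v: "v \<in> var_words \<alpha> \<upsilon> k" "dom v \<subseteq> {Max (dom u)<..}" "v \<in> (\<Inter>i\<in>F \<times> {..N}. ?B i)"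
      using ultra_empty[OF ultra] by (cases "?X = {}") auto
    have "word_less u v" using v(1,2) by (auto simp: word_less_def var_words_def)
    then show ?thesis using v(1,3) by (intro bexI[of _ v]) auto
  qed
  \<comment> \<open>The state of the construction is the current word together with the set of all products so
    far, each tagged with whether the variable occurs; the empty product is included.\<close>
  define ext where "ext n F v = F \<union> (\<lambda>((b, x), p). (b \<or> p = 0, x ++ ?T p v)) ` (F \<times> {..k n})"
    for n v and F :: "(bool \<times> 'a partial_word) set"
  let ?P = "\<lambda>s. fst s \<in> var_words \<alpha> \<upsilon> k \<and> finite (snd s) \<and> (False, Map.empty) \<in> snd s \<and> (\<forall>(b, x)\<in>snd s. x \<in> G b)"
  let ?Q = "\<lambda>n s t. word_less (fst s) (fst t) \<and> snd t = ext (Suc n) (snd s) (fst t) \<and>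
      (\<forall>(b, x)\<in>snd s. \<forall>p\<le>k (Suc n). x ++ ?T p (fst t) \<in> D (b \<or> p = 0))"
  have "\<exists>f. \<forall>n. ?P (f n) \<and> ?Q n (f n) (f (Suc n))"
  proof (rule dependent_nat_choice)
    \<comment> \<open>A placeholder for index 0: \<open>ext\<close> is applied to
      \<open>w (Suc n)\<close> only, so \<open>w 0\<close> enters no product considered
      below.\<close>
    have "[1 \<mapsto> \<upsilon>] \<in> var_words \<alpha> \<upsilon> k" by (auto simp: var_words_def)
    moreover have "Map.empty \<in> G False" using D by (simp add: G_def)
    ultimately show "\<exists>s. ?P s" by (intro exI[of _ "([1 \<mapsto> \<upsilon>], {(False, Map.empty)})"]) auto
  next
    fix s n assume s: "?P s"
    then obtain v where v: "v \<in> var_words \<alpha> \<upsilon> k" "word_less (fst s) v"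
      "\<forall>(b, x)\<in>snd s. \<forall>p\<le>k (Suc n). x ++ ?T p v \<in> D (b \<or> p = 0) \<inter> G (b \<or> p = 0)"
      using step[of "snd s" "fst s" "k (Suc n)"] by blast
    have "\<forall>(b, x)\<in>ext (Suc n) (snd s) v. x \<in> G b"
    proof safe
      fix b x assume "(b, x) \<in> ext (Suc n) (snd s) v"
      then consider "(b, x) \<in> snd s"
        | c y p where "(c, y) \<in> snd s" "p \<le> k (Suc n)" "b = (c \<or> p = 0)" "x = y ++ ?T p v"
        by (auto simp: ext_def)
      then show "x \<in> G b" using s v(3) by cases auto
    qed
    moreover have "finite (ext (Suc n) (snd s) v)" "(False, Map.empty) \<in> ext (Suc n) (snd s) v"
      using s by (simp_all add: ext_def)
    moreover have "\<forall>(b, x)\<in>snd s. \<forall>p\<le>k (Suc n). x ++ ?T p v \<in> D (b \<or> p = 0)"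
      using v(3) by blast
    ultimately show "\<exists>t. ?P t \<and> ?Q n s t"
      using v(1,2) by (intro exI[of _ "(v, ext (Suc n) (snd s) v)"]) simp
  qed
  then obtain f where f: "\<And>n. ?P (f n)" "\<And>n. ?Q n (f n) (f (Suc n))" by blast
  define w F where "w n = fst (f n)" and "F n = snd (f n)" for n
  have F_Suc: "F (Suc n) = ext (Suc n) (F n) (w (Suc n))" for n using f(2) by (simp add: F_def w_def)
  have F_D: "x ++ ?T p (w (Suc n)) \<in> D (b \<or> p = 0)" if "(b, x) \<in> F n" "p \<le> k (Suc n)" for b x p n
    using f(2)[of n] that by (auto simp: F_def w_def)
  have F_mono: "F m \<subseteq> F n" if "m \<le> n" for m n
    by (rule lift_Suc_mono_le[OF _ that]) (simp add: F_Suc ext_def)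
  \<comment> \<open>Membership in \<open>F N\<close> is carried along because, for last index
    \<open>Suc m\<close>, the extension step starts from an earlier product in \<open>F m\<close>.
    The guard excludes the empty product, which is recorded in \<open>F N\<close> but not claimed to
    lie in \<open>D False\<close>.\<close>
  have main: "(0 \<in> set ps, subst_product \<alpha> \<upsilon> k w ps ns) \<in> F N \<and>
      (ns \<noteq> [] \<longrightarrow> subst_product \<alpha> \<upsilon> k w ps ns \<in> D (0 \<in> set ps))"
    if "list_all2 (\<lambda>p n. p \<le> k n) ps ns" "set ns \<subseteq> {1..N}" "sorted_wrt (<) ns" for ps ns N
    using that
  proof (induction ns arbitrary: ps N rule: rev_induct)
    case Nil
    then show ?case using f(1)[of N] by (simp add: subst_product_def star_list_def F_def)
  next
    case (snoc n ns)
    obtain qs p where ps: "ps = qs @ [p]" and p: "p \<le> k n" and qs: "list_all2 (\<lambda>p n. p \<le> k n) qs ns"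
      using snoc.prems(1) by (auto simp: list_all2_append2 list_all2_Cons2)
    obtain m where n: "n = Suc m" "Suc m \<le> N" using snoc.prems(2) by (cases n) auto
    have "set ns \<subseteq> {1..m}" "sorted_wrt (<) ns"
      using snoc.prems(2,3) n by (auto simp: sorted_wrt_append less_Suc_eq_le)
    then have IH: "(0 \<in> set qs, subst_product \<alpha> \<upsilon> k w qs ns) \<in> F m" using snoc.IH qs by blast
    have eq: "subst_product \<alpha> \<upsilon> k w ps (ns @ [n]) = subst_product \<alpha> \<upsilon> k w qs ns ++ ?T p (w (Suc m))"
      "(0 \<in> set ps) = (0 \<in> set qs \<or> p = 0)"
      using subst_product_snoc list_all2_lengthD[OF qs] by (auto simp: ps n)
    have "(0 \<in> set ps, subst_product \<alpha> \<upsilon> k w ps (ns @ [n])) \<in> F (Suc m)"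
      unfolding F_Suc ext_def eq using IH p n(1)
      by (intro UnI2 image_eqI[of _ _ "((0 \<in> set qs, subst_product \<alpha> \<upsilon> k w qs ns), p)"]) auto
    then show ?case using F_mono[OF n(2)] F_D[OF IH] p n(1) unfolding eq by blast
  qed
  show thesis
  proof
    show "w n \<in> var_words \<alpha> \<upsilon> k" "word_less (w n) (w (Suc n))" for n
      using f(1)[of n] f(2)[of n] by (auto simp: w_def)
    fix ps ns
    assume "ns \<noteq> []" "list_all2 (\<lambda>p n. p \<le> k n) ps ns" "set ns \<subseteq> {1..}" "sorted_wrt (<) ns"
    moreover from \<open>set ns \<subseteq> {1..}\<close> have "set ns \<subseteq> {1..Max (set ns)}" by auto
    ultimately show "subst_product \<alpha> \<upsilon> k w ps ns \<in> D (0 \<in> set ps)" using main by blast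
  qed
qed

section \<open>Choice of the two colours\<close>

theorem theorem1p1:
  fixes \<alpha> :: "nat \<Rightarrow> 'a" and \<upsilon> :: 'a and k :: "nat \<Rightarrow> nat" and r s :: nat
    and A C :: "nat \<Rightarrow> 'a partial_word set"
  assumes "inj_on \<alpha> {1..}" and "\<upsilon> \<notin> \<alpha> ` {1..}"
    and "\<forall>n\<ge>1. k n \<ge> 1" and "r \<ge> 1" and "s \<ge> 1"
    and "var_words \<alpha> \<upsilon> k = (\<Union>i\<in>{1..r}. A i)"
    and "const_words \<alpha> k = (\<Union>j\<in>{1..s}. C j)"
  shows "\<exists>(w :: nat \<Rightarrow> 'a partial_word) i\<^sub>0 j\<^sub>0.
    (\<forall>n\<ge>1. w n \<in> var_words \<alpha> \<upsilon> k) \<and>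
    (\<forall>n\<ge>1. word_less (w n) (w (n + 1))) \<and>
    1 \<le> i\<^sub>0 \<and> i\<^sub>0 \<le> r \<and> 1 \<le> j\<^sub>0 \<and> j\<^sub>0 \<le> s \<and>
    (\<forall>l\<ge>1. \<forall>ns ps. length ns = l \<longrightarrow> length ps = l \<longrightarrow> set ns \<subseteq> {1..} \<longrightarrow> sorted_wrt (<) ns \<longrightarrow>
       (\<forall>i<l. 0 \<le> ps ! i \<and> ps ! i \<le> k (ns ! i)) \<longrightarrow> 0 \<in> set ps \<longrightarrow>
       subst_product \<alpha> \<upsilon> k w ps ns \<in> A i\<^sub>0) \<and>
    (\<forall>l\<ge>1. \<forall>ns ps. length ns = l \<longrightarrow> length ps = l \<longrightarrow> set ns \<subseteq> {1..} \<longrightarrow> sorted_wrt (<) ns \<longrightarrow>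
       (\<forall>i<l. 1 \<le> ps ! i \<and> ps ! i \<le> k (ns ! i)) \<longrightarrow>
       subst_product \<alpha> \<upsilon> k w ps ns \<in> C j\<^sub>0)"
proof -
  obtain W where W: "W True \<in> tail_ultra (var_words \<alpha> \<upsilon> k)" "W False \<in> tail_ultra (const_words \<alpha> k)"
    and mult: "\<And>b c. ultra_mult (++) (W b) (W c) = W (b \<or> c)"
    and T: "\<And>p. ultra_map (subst_word \<alpha> \<upsilon> k p) (W True) = W (p = 0)"
    by (rule idempotents_exist[OF assms(2,3)]) (rule that; assumption)
  \<comment> \<open>An ultrafilter containing a finite union contains one of its members; this
    selects both colours.\<close>
  have "W True (\<Union>i\<in>{1..r}. A i)" "W False (\<Union>j\<in>{1..s}. C j)"
    unfolding assms(6,7)[symmetric] using tail_ultraD(3) W by blast+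
  then obtain i j where i: "i \<in> {1..r}" "W True (A i)" and j: "j \<in> {1..s}" "W False (C j)"
    using tail_ultraD(1)[OF W(1)] tail_ultraD(1)[OF W(2)] by (meson finite_atLeastAtMost ultra_finite_UN)
  define D where "D b = (if b then A i else C j)" for b
  have "W b (D b)" for b using i j by (cases b) (simp_all add: D_def)
  then obtain w where w: "\<And>n. w n \<in> var_words \<alpha> \<upsilon> k" "\<And>n. word_less (w n) (w (Suc n))"
    "\<And>ps ns. ns \<noteq> [] \<Longrightarrow> list_all2 (\<lambda>p n. p \<le> k n) ps ns \<Longrightarrow> set ns \<subseteq> {1..} \<Longrightarrow> sorted_wrt (<) ns \<Longrightarrow>
      subst_product \<alpha> \<upsilon> k w ps ns \<in> D (0 \<in> set ps)"
    using word_sequence_exists[OF W mult T, of D] by blast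
  show ?thesis
  proof (rule exI[of _ w], rule exI[of _ i], rule exI[of _ j], intro conjI allI impI)
    fix l and ns ps :: "nat list"
    assume l: "1 \<le> l" "length ns = l" "length ps = l" and ns: "set ns \<subseteq> {1..}" "sorted_wrt (<) ns"
    have *: "subst_product \<alpha> \<upsilon> k w ps ns \<in> D (0 \<in> set ps)" if "\<forall>i<l. ps ! i \<le> k (ns ! i)"
      using l ns that by (intro w(3)) (auto simp: list_all2_conv_all_nth)
    show "subst_product \<alpha> \<upsilon> k w ps ns \<in> A i"
      if "\<forall>i<l. 0 \<le> ps ! i \<and> ps ! i \<le> k (ns ! i)" "0 \<in> set ps"
      using * that by (simp add: D_def)
    show "subst_product \<alpha> \<upsilon> k w ps ns \<in> C j" if "\<forall>i<l. 1 \<le> ps ! i \<and> ps ! i \<le> k (ns ! i)"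
    proof -
      \<comment> \<open>No exponent vanishes, so the tag is \<open>False\<close> and the target is
        \<open>C j\<close>.\<close>
      have "0 \<notin> set ps" using that l by (auto simp: in_set_conv_nth)
      then show ?thesis using * that by (simp add: D_def)
    qed
  qed (use w i j in auto)
qed

end
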